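(* Let $n\ge1$ be an integer. The $n$-th antiperiodic generation $\tilde f_n(x)=\frac{1}{2^n}\sum_{k=0}^{2^n-1}(-1)^k\left\{x+\frac{k}{2^n}\right\}$ of the fractional part function $\{x\}$ can be written alternatively, without summation, as $$\tilde f_n(x)=-\frac{(-1)^{\lfloor 2^nx\rfloor}}{2^{n+1}}\quad\text{for all }x\in\mathbb{R}.$$
   Context: $\{x\}=x-\lfloor x\rfloor$ is the fractional part of $x\in\mathbb{R}$ and $\lfloor\cdot\rfloor$ is the floor function. For $q>0$, a function $g:\mathbb{R}\to\mathbb{R}$ is $q$-antiperiodic if $g(x+q)=-g(x)$ for all $x$. The name "$n$-th antiperiodic generation" refers to the following recursion: with $f_0(x)=\{x\}$, for $n\ge1$ the $1/2^{n-1}$-periodic function $f_{n-1}$ is uniquely decomposed as $f_{n-1}=f_n+\tilde f_n$ with $f_n$ being $1/2^n$-periodic and $\tilde f_n$ being $1/2^n$-antiperiodic; the explicit sum in the claim may be taken as the definition of $\tilde f_n$. *)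

theory Defs
  imports Complex_Main
begin

text \<open>The \<open>n\<close>-th antiperiodic generation of the fractional part function, given by its
  explicit sum. It is the \<open>1/2^n\<close>-antiperiodic summand in the decomposition of the
  \<open>1/2^(n-1)\<close>-periodic function \<open>f\<^sub>n\<^sub>-\<^sub>1\<close> into a \<open>1/2^n\<close>-periodic and a
  \<open>1/2^n\<close>-antiperiodic function, where \<open>f\<^sub>0 = frac\<close>.\<close>

definition antiperiodic_generation :: "nat \<Rightarrow> real \<Rightarrow> real" where
  "antiperiodic_generation n x =
     1 / 2 ^ n * (\<Sum>k<2 ^ n. (- 1) ^ k * frac (x + real k / 2 ^ n))"

end

theory Submission
  imports Defs
begin

text \<open>
  Write \<open>N = 2 ^ n\<close>, an even number. Adding \<open>1 / N\<close> to \<open>x\<close> shifts the alternating sum by one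
  index; as \<open>N\<close> is even and \<open>frac\<close> has period \<open>1\<close>, the term that enters at \<open>k = N\<close> is the term
  that leaves at \<open>k = 0\<close>, so the sum merely changes its sign
  (\<open>alternating_sum_antiperiodic\<close>). Hence \<open>x\<close> may be moved by \<open>\<lfloor>N * x\<rfloor>\<close> steps of length
  \<open>1 / N\<close> into \<open>[0, 1 / N)\<close> at the price of the sign \<open>(-1) powi \<lfloor>N * x\<rfloor>\<close>
  (\<open>antiperiodic_int_shift\<close>). On that interval all arguments \<open>x + k / N\<close> lie in \<open>[0, 1)\<close>, where
  \<open>frac\<close> is the identity; pairing neighbouring terms cancels \<open>x\<close> and leaves \<open>N / 2\<close> copies of
  \<open>- 1 / N\<close>, so the sum is \<open>- 1 / 2\<close> (\<open>alternating_frac_sum_base\<close>).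
\<close>

lemma antiperiodic_int_shift:
  fixes g :: "real \<Rightarrow> real" and q :: real
  assumes anti: "\<And>x. g (x + q) = - g x"
  shows "g (x + of_int m * q) = (- 1) powi m * g x"
proof (induction m rule: int_induct[where k = 0])
  case base
  show ?case by simp
next
  case (step1 i)
  have "g (x + of_int (i + 1) * q) = g ((x + of_int i * q) + q)"
    by (simp add: algebra_simps)
  then show ?case
    using step1 by (simp add: anti power_int_add)
next
  case (step2 i)
  have "g (x + of_int i * q) = g ((x + of_int (i - 1) * q) + q)"
    by (simp add: algebra_simps)
  then show ?case
    using step2 by (simp add: anti power_int_diff)
qed

text \<open>The evenness of \<open>N\<close> is what makes the sign of the entering term \<open>k = N\<close> agree with that of
  the leaving term \<open>k = 0\<close>.\<close>

lemma alternating_sum_antiperiodic: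
  fixes g :: "real \<Rightarrow> real"
  assumes per: "\<And>x. g (x + 1) = g x" and N: "even N" "N > 0"
  shows "(\<Sum>k<N. (- 1) ^ k * g ((x + 1 / real N) + real k / real N))
           = - (\<Sum>k<N. (- 1) ^ k * g (x + real k / real N))"
proof -
  define a where "a k = (- 1) ^ k * g (x + real k / real N)" for k
  have "(\<Sum>k<N. (- 1) ^ k * g ((x + 1 / real N) + real k / real N)) = - (\<Sum>k<N. a (Suc k))"
    by (simp add: a_def sum_negf add_divide_distrib add.assoc)
  also have "(\<Sum>k<N. a (Suc k)) = (\<Sum>k<N. a k) + a N - a 0"
    using sum.lessThan_Suc_shift[of a N] by simp
  also have "a N = a 0"
    using N per[of x] by (simp add: a_def)
  finally show ?thesis by (simp add: a_def)
qed

lemma alternating_arithmetic_sum: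
  fixes t c :: real
  shows "(\<Sum>k<2 * M. (- 1) ^ k * (t + real k * c)) = - real M * c"
  by (induction M) (simp_all add: algebra_simps)

lemma alternating_frac_sum_base:
  fixes t :: real
  assumes N: "even N" "N > 0" and t: "0 \<le> t" "t < 1 / real N"
  shows "(\<Sum>k<N. (- 1) ^ k * frac (t + real k / real N)) = - 1 / 2"
proof -
  obtain M where M: "N = 2 * M" using N by blast
  have "frac (t + real k / real N) = t + real k * (1 / real N)" if "k < N" for k
  proof -
    have "t + real k / real N < (1 + real k) / real N"
      using t by (simp add: add_divide_distrib)
    also have "\<dots> \<le> 1"
      using that by simp
    finally show ?thesis
      using t by (simp add: frac_eq)
  qed
  then have "(\<Sum>k<N. (- 1) ^ k * frac (t + real k / real N))
               = (\<Sum>k<N. (- 1) ^ k * (t + real k * (1 / real N)))"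
    by (intro sum.cong) auto
  also have "\<dots> = - real M * (1 / real N)"
    using alternating_arithmetic_sum[where M = M] M by metis
  also have "\<dots> = - 1 / 2"
    using N M by simp
  finally show ?thesis .
qed

lemma alternating_frac_sum:
  fixes x :: real
  assumes N: "even N" "N > 0"
  shows "(\<Sum>k<N. (- 1) ^ k * frac (x + real k / real N)) = - ((- 1) powi \<lfloor>real N * x\<rfloor> / 2)"
proof -
  define S where "S y = (\<Sum>k<N. (- 1) ^ k * frac (y + real k / real N))" for y :: real
  define m where "m = \<lfloor>real N * x\<rfloor>"
  define t where "t = x - of_int m * (1 / real N)"
  have "of_int m \<le> real N * x" "real N * x < of_int m + 1"
    by (simp_all add: m_def)
  moreover have "t = (real N * x - of_int m) / real N"
    using N by (simp add: t_def diff_divide_distrib)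
  ultimately have t: "0 \<le> t" "t < 1 / real N"
    using N by (simp_all add: divide_strict_right_mono)
  have "S (y + 1 / real N) = - S y" for y
    unfolding S_def by (rule alternating_sum_antiperiodic[OF _ N]) (simp add: frac_1_eq)
  then have "S (t + of_int m * (1 / real N)) = (- 1) powi m * S t"
    by (rule antiperiodic_int_shift)
  moreover have "S t = - 1 / 2"
    unfolding S_def by (rule alternating_frac_sum_base[OF N t])
  ultimately show ?thesis
    by (simp add: S_def t_def m_def)
qed

theorem theorem2p13:
  fixes n :: nat
  assumes "n \<ge> 1"
  shows "\<forall>x::real. antiperiodic_generation n x =
           - ((- 1) powi \<lfloor>2 ^ n * x\<rfloor> / 2 ^ (n + 1))"
proof
  fix x :: real
  have "even (2 ^ n :: nat)" "(2 ^ n :: nat) > 0"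
    using assms by simp_all
  from alternating_frac_sum[OF this, of x]
  show "antiperiodic_generation n x = - ((- 1) powi \<lfloor>2 ^ n * x\<rfloor> / 2 ^ (n + 1))"
    by (simp add: antiperiodic_generation_def)
qed

end
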